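(* Let $(p(\cdot|\theta))_{\theta\in\Theta}$ be an exponential family of probability densities on a measurable space $\mathbf{X}$ with respect to some measure on $\mathbf{X}$, of the form $$p(\mathbf{x}|\theta)=e^{\theta T(\mathbf{x})}c(\theta)q(\mathbf{x}),\qquad \mathbf{x}\in\mathbf{X},\ \theta\in\Theta,$$ where $\Theta\subseteq\mathbb{R}$ is a nonempty Borel set, $c$ is a positive Borel-measurable function on $\Theta$, $T$ and $q$ are nonnegative measurable functions on $\mathbf{X}$, and $p(\mathbf{x}|\theta)$ is measurable in $(\mathbf{x},\theta)$. Suppose that $\theta_{\max}:=\sup\Theta<\infty$. Let $\pi$ be a Borel measure on $\Theta$ (not necessarily a probability measure), normalized so that $\int_\Theta c(\theta)\,\pi(d\theta)=1$, and such that $\operatorname{supp}\pi\ne\{\theta_{\max}\}$. Let $m:=\int_\Theta\theta\,c(\theta)\,\pi(d\theta)$ (so that $m<\theta_{\max}$), and suppose that $\int_\Theta(\theta-m)^2c(\theta)\,\pi(d\theta)\le\sigma^2$ for some $\sigma\in(0,\infty)$. For $\mathbf{x}\in\mathbf{X}$ with $q(\mathbf{x})\ne0$, consider the posterior mean $$\hat\theta(\mathbf{x}):=\frac{\int_\Theta\theta\,p(\mathbf{x}|\theta)\,\pi(d\theta)}{\int_\Theta p(\mathbf{x}|\theta)\,\pi(d\theta)}=\frac{\int_\Theta\theta e^{\theta t}c(\theta)\,\pi(d\theta)}{\int_\Theta e^{\theta t}c(\theta)\,\pi(d\theta)},\qquad t:=T(\mathbf{x}).$$ Then for every $\mathbf{x}\in\mathbf{X}$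 with $q(\mathbf{x})\ne0$ and $t=T(\mathbf{x})>0$, $$\hat\theta(\mathbf{x})-m\le\mathcal{S}_{t,\,\theta_{\max}-m,\,\sigma}<\frac{e^{(\theta_{\max}-m)t}-1}{\theta_{\max}-m}\,\sigma^2.$$
   Context: For $h,\sigma\in(0,\infty)$ and $w\in\mathbb{R}$, $$\mathcal{S}_{h,w,\sigma}:=\sup\left\{\frac{\mathsf{E}\,Xe^{h(X\wedge w)}}{\mathsf{E}\,e^{h(X\wedge w)}}\colon X\text{ is a real random variable with }\mathsf{E}X=0,\ \mathsf{E}X^2=\sigma^2\right\},$$ where $x\wedge w=\min(x,w)$; $\mathcal{S}_{t,\theta_{\max}-m,\sigma}$ is this quantity with $h=t$ and $w=\theta_{\max}-m$. The support of a Borel measure is the complement of the union of all open sets of measure zero. *)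

theory Defs
  imports "HOL-Probability.Probability"
begin

text \<open>
  The supremum is taken in \<^typ>\<open>ereal\<close>, so that boundedness is not presupposed. The
  ratio depends only on the distribution of \<open>X\<close>, so sample spaces over \<^typ>\<open>real\<close>
  suffice: see \<open>tilted_mean_mem\<close> below.
\<close>

definition tilted_mean :: "'a measure \<Rightarrow> ('a \<Rightarrow> real) \<Rightarrow> real \<Rightarrow> real \<Rightarrow> real" where
  "tilted_mean M X h w =
     (\<integral>s. X s * exp (h * min (X s) w) \<partial>M) / (\<integral>s. exp (h * min (X s) w) \<partial>M)"

definition centered_rv :: "'a measure \<Rightarrow> ('a \<Rightarrow> real) \<Rightarrow> real \<Rightarrow> bool" where
  "centered_rv M X \<sigma> \<longleftrightarrow>
     prob_space M \<and> X \<in> borel_measurable M \<and>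
     integrable M X \<and> (\<integral>s. X s \<partial>M) = 0 \<and>
     integrable M (\<lambda>s. (X s)\<^sup>2) \<and> (\<integral>s. (X s)\<^sup>2 \<partial>M) = \<sigma>\<^sup>2"

definition tilted_mean_sup :: "real \<Rightarrow> real \<Rightarrow> real \<Rightarrow> ereal" where
  "tilted_mean_sup h w \<sigma> =
     Sup {ereal (tilted_mean M X h w) | (M :: real measure) X. centered_rv M X \<sigma>}"

lemma tilted_mean_mem:
  fixes M :: "'a measure"
  assumes "centered_rv M X \<sigma>"
  shows "ereal (tilted_mean M X h w) \<in>
     {ereal (tilted_mean N Y h w) | (N :: real measure) Y. centered_rv N Y \<sigma>}"
proof -
  have [measurable]: "X \<in> borel_measurable M" and "prob_space M"
    using assms by (auto simp: centered_rv_def)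
  let ?N = "distr M borel X"
  have "prob_space ?N"
    using \<open>prob_space M\<close> by (rule prob_space.prob_space_distr) simp
  then have "centered_rv ?N (\<lambda>x. x) \<sigma>"
    using assms by (simp add: centered_rv_def integrable_distr_eq integral_distr)
  moreover have "tilted_mean ?N (\<lambda>x. x) h w = tilted_mean M X h w"
    by (simp add: tilted_mean_def integral_distr)
  ultimately show ?thesis
    by (smt (verit, best) mem_Collect_eq)
qed

text \<open>The topology is the subspace topology of the space carrying the measure.\<close>

definition measure_support :: "'a::topological_space measure \<Rightarrow> 'a set" where
  "measure_support \<mu> =
     space \<mu> - \<Union>{U. openin (top_of_set (space \<mu>)) U \<and> emeasure \<mu> U = 0}"

definition posterior_mean :: "real measure \<Rightarrow> ('x \<Rightarrow> real \<Rightarrow> real) \<Rightarrow> 'x \<Rightarrow> real" where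
  "posterior_mean \<pi> p x = (\<integral>\<theta>. \<theta> * p x \<theta> \<partial>\<pi>) / (\<integral>\<theta>. p x \<theta> \<partial>\<pi>)"

end

theory Submission imports Defs
begin

text \<open>
  Under the probability measure \<open>c \<pi>\<close> the variable \<open>X = \<theta> - m\<close> is centred, has variance at most
  \<open>\<sigma>\<^sup>2\<close>, and never exceeds \<open>w = \<theta>max - m\<close>. The truncation at \<open>w\<close> is therefore invisible to it,
  and \<open>posterior_mean \<pi> p x - m\<close> is exactly its tilted mean with \<open>h = T x\<close>. A variance strictly
  below \<open>\<sigma>\<^sup>2\<close> is raised to \<open>\<sigma>\<^sup>2\<close> by mixing in, with small probability, two symmetric atoms
  \<open>R\<close> and \<open>- R\<close>; for large \<open>R\<close> this does not lower the tilted mean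
  (\<open>tilted_mean_le_sup_of_smaller_variance\<close>). That gives the first inequality.

  For the second one put \<open>K = (exp (h * w) - 1) / w\<close>, \<open>s = K * \<sigma>\<^sup>2\<close> and
  \<open>\<phi> x = exp (h * min x w)\<close>. That the tilted mean is at most \<open>s\<close> says that \<open>(X - s) * \<phi> X\<close> has
  nonpositive expectation. Since only the first two moments of \<open>X\<close> are known, one looks for a
  quadratic \<open>a * x + b * x\<^sup>2 + d\<close> above \<open>(x - s) * \<phi> x\<close>, whose expectation is \<open>b * \<sigma>\<^sup>2 + d\<close>.
  If this number is negative, then, as \<open>\<phi>\<close> is bounded by \<open>exp (h * w)\<close>, all tilted means stay
  below \<open>s\<close> by one common positive amount, so that even the supremum is strictly below \<open>s\<close>
  (\<open>tilted_mean_le_of_quadratic_majorant\<close>).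

  No single shape of quadratic serves for all \<open>\<sigma>\<close>. If \<open>h * \<sigma>\<^sup>2 \<le> w\<close>, the quadratic tangent at
  \<open>0\<close> with leading coefficient slightly less than \<open>K\<close> works; this is a perturbation of the elementary
  bound \<open>x * (\<phi> x - 1) \<le> K * x\<^sup>2\<close>. If \<open>\<sigma>\<close> is large, such a parabola is crossed somewhere beyond \<open>w\<close>; so for \<open>h * \<sigma>\<^sup>2 > w\<close>
  \<open>(x - s) * l x\<close> is used instead, where \<open>l\<close> is a line that meets \<open>\<phi>\<close> at \<open>s\<close> and lies below \<open>\<phi>\<close> to the
  left of \<open>s\<close> and above it to the right.
\<close>

section \<open>Tilted means and quadratic majorants\<close>

lemma tilt_integrals:
  fixes X :: "'a \<Rightarrow> real"
  assumes "prob_space M" "integrable M X" "0 < h"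
  shows "integrable M (\<lambda>s. exp (h * min (X s) w))"
    and "integrable M (\<lambda>s. X s * exp (h * min (X s) w))"
    and "0 < (\<integral>s. exp (h * min (X s) w) \<partial>M)"
    and "(\<integral>s. exp (h * min (X s) w) \<partial>M) \<le> exp (h * w)"
proof -
  interpret prob_space M by fact
  have [measurable]: "X \<in> borel_measurable M" using assms by auto
  have le: "exp (h * min x w) \<le> exp (h * w)" for x
    using \<open>0 < h\<close> by simp
  show i: "integrable M (\<lambda>s. exp (h * min (X s) w))"
    by (rule integrable_const_bound[where B="exp (h * w)"]) (use le in auto)
  show "integrable M (\<lambda>s. X s * exp (h * min (X s) w))"
  proof (rule Bochner_Integration.integrable_bound)
    show "integrable M (\<lambda>s. X s * exp (h * w))" using assms by auto
    show "AE s in M. norm (X s * exp (h * min (X s) w)) \<le> norm (X s * exp (h * w))"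
      by (intro AE_I2) (unfold norm_mult, intro mult_left_mono, use le in auto)
  qed simp
  have "(\<integral>s. exp (h * min (X s) w) \<partial>M) \<noteq> 0"
    using i by (subst integral_nonneg_eq_0_iff_AE) auto
  moreover have "0 \<le> (\<integral>s. exp (h * min (X s) w) \<partial>M)"
    by (rule integral_nonneg_AE) auto
  ultimately show "0 < (\<integral>s. exp (h * min (X s) w) \<partial>M)" by linarith
  have "(\<integral>s. exp (h * min (X s) w) \<partial>M) \<le> (\<integral>s. exp (h * w) \<partial>M)"
    by (rule integral_mono) (use i le in auto)
  then show "(\<integral>s. exp (h * min (X s) w) \<partial>M) \<le> exp (h * w)"
    by (simp add: prob_space)
qed

text \<open>
  The division by \<open>exp (h * w)\<close>, an upper bound of the normalizing integral, makes the gap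
  independent of the distribution; it is what keeps the inequality strict in the supremum.
\<close>

lemma tilted_mean_le_of_quadratic_majorant:
  assumes X: "centered_rv M X \<sigma>" and h: "0 < h"
    and majorant: "\<And>x. (x - s) * exp (h * min x w) \<le> a * x + b * x\<^sup>2 + d"
    and neg: "b * \<sigma>\<^sup>2 + d \<le> 0"
  shows "tilted_mean M X h w \<le> s + (b * \<sigma>\<^sup>2 + d) / exp (h * w)"
proof -
  interpret prob_space M using X by (simp add: centered_rv_def)
  have iX: "integrable M X" "(\<integral>s. X s \<partial>M) = 0"
    and iX2: "integrable M (\<lambda>s. (X s)\<^sup>2)" "(\<integral>s. (X s)\<^sup>2 \<partial>M) = \<sigma>\<^sup>2"
    using X by (auto simp: centered_rv_def)
  note tilt = tilt_integrals[OF prob_space_axioms iX(1) h, of w]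
  let ?D = "\<integral>z. exp (h * min (X z) w) \<partial>M"
  let ?N = "\<integral>z. X z * exp (h * min (X z) w) \<partial>M"
  have "?N - s * ?D = (\<integral>z. (X z - s) * exp (h * min (X z) w) \<partial>M)"
    using tilt(1,2) by (simp add: algebra_simps)
  also have "\<dots> \<le> (\<integral>z. a * X z + b * (X z)\<^sup>2 + d \<partial>M)"
    by (rule integral_mono) (use tilt(1,2) iX iX2 majorant in \<open>auto simp: left_diff_distrib\<close>)
  also have "\<dots> = b * \<sigma>\<^sup>2 + d"
    using iX iX2 by (simp add: prob_space)
  finally have "?N / ?D \<le> s + (b * \<sigma>\<^sup>2 + d) / ?D"
    using tilt(3) by (simp add: field_simps)
  also have "\<dots> \<le> s + (b * \<sigma>\<^sup>2 + d) / exp (h * w)"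
    using tilt(3,4) neg by (intro add_left_mono divide_left_mono_neg) auto
  finally show ?thesis by (simp add: tilted_mean_def)
qed

section \<open>Majorants for small and large variance\<close>

lemma rate_less_chord_slope:
  fixes h w :: real
  assumes "0 < h" "0 < w"
  shows "h < (exp (h * w) - 1) / w"
  using exp_minus_greater[of "- (h * w)"] assms by (simp add: field_simps)

lemma exp_minus_one_le_chord:
  fixes h w x :: real
  assumes "0 < h" "0 < w" "0 \<le> x" "x \<le> w"
  shows "exp (h * x) - 1 \<le> (exp (h * w) - 1) / w * x"
proof -
  have "exp (h * x) \<le> (exp (h * w) - exp 0) / (h * w - 0) * (h * x - 0) + exp 0"
    by (rule convex_onD_Icc'[OF convex_on_subset[OF exp_convex]]) (use assms in auto)
  then show ?thesis using assms by (simp add: mult.assoc)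
qed

text \<open>
  With leading coefficient \<open>K\<close> the expectation of the majorant would be \<open>0\<close>, so some \<open>b < K\<close> is
  needed. On \<open>x \<le> 0\<close> the coefficient \<open>h < K\<close> suffices, and on \<open>0 \<le> x \<le> w\<close> the term
  \<open>- s * (exp (h * x) - 1 - h * x)\<close> leaves a quadratic gap. Beyond \<open>w\<close> the gap for coefficient \<open>K\<close> is
  \<open>K * ((x - w) * (x - h * \<sigma>\<^sup>2) + \<sigma>\<^sup>2 * w * (K - h))\<close>, positive because \<open>h * \<sigma>\<^sup>2 \<le> w\<close>.
\<close>

lemma majorant_small_variance:
  fixes h w \<sigma> :: real
  defines "K \<equiv> (exp (h * w) - 1) / w"
  assumes pos: "0 < h" "0 < w" "0 < \<sigma>" and small: "h * \<sigma>\<^sup>2 \<le> w"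
  obtains b where "b < K"
    "\<And>x. (x - K * \<sigma>\<^sup>2) * exp (h * min x w)
      \<le> (1 - h * (K * \<sigma>\<^sup>2)) * x + b * x\<^sup>2 + - (K * \<sigma>\<^sup>2)"
proof -
  define s where "s = K * \<sigma>\<^sup>2"
  have hK: "h < K" unfolding K_def using rate_less_chord_slope pos by blast
  have K: "0 < K" using hK pos by simp
  have s: "0 < s" using K pos by (simp add: s_def)
  have Kw: "exp (h * w) = 1 + K * w" using pos by (simp add: K_def)
  \<comment> \<open>The entries are the reductions of \<open>K\<close> that the following regions can afford, in this order:
    \<open>x \<le> 0\<close>, then \<open>0 \<le> x \<le> w\<close>, then \<open>2 * w \<le> x\<close>, and \<open>w \<le> x \<le> 2 * w\<close>.\<close>
  define e where "e = Min {K - h, s * h\<^sup>2 / 2, K / 4, K * (\<sigma>\<^sup>2 * (K - h)) / (4 * w)}"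
  have e0: "0 < e" unfolding e_def using hK K s pos by auto
  have e: "e \<le> K - h" "e \<le> s * h\<^sup>2 / 2" "e \<le> K / 4" "e \<le> K * (\<sigma>\<^sup>2 * (K - h)) / (4 * w)"
    unfolding e_def by (rule Min_le; simp)+
  show ?thesis
  proof (rule that[of "K - e"])
    show "K - e < K" using e0 by simp
    fix x :: real
    consider "x \<le> 0" | "0 \<le> x" "x \<le> w" | "w \<le> x" by linarith
    then have "(x - s) * exp (h * min x w) \<le> (1 - h * s) * x + (K - e) * x\<^sup>2 + - s"
    proof cases
      case 1
      have lin: "1 + h * x \<le> exp (h * x)" by (rule exp_ge_add_one_self)
      have "x * (exp (h * x) - 1 - h * x) \<le> 0"
        using 1 lin by (intro mult_nonpos_nonneg) linarith+
      moreover have "0 \<le> s * (exp (h * x) - 1 - h * x)"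
        using s lin by (intro mult_nonneg_nonneg) linarith+
      moreover have "h * x\<^sup>2 \<le> (K - e) * x\<^sup>2" using e(1) by (intro mult_right_mono) auto
      ultimately show ?thesis using 1 pos by (simp add: algebra_simps power2_eq_square)
    next
      case 2
      have "x * (exp (h * x) - 1) \<le> x * (K * x)"
        using exp_minus_one_le_chord[OF pos(1,2) 2] 2 by (intro mult_left_mono) (auto simp: K_def)
      moreover have "s * ((h * x)\<^sup>2 / 2) \<le> s * (exp (h * x) - 1 - h * x)"
        using exp_lower_Taylor_quadratic[of "h * x"] 2 pos s by (intro mult_left_mono) auto
      moreover have "e * x\<^sup>2 \<le> s * h\<^sup>2 / 2 * x\<^sup>2" using e(2) by (intro mult_right_mono) auto
      ultimately show ?thesis using 2 by (simp add: algebra_simps power2_eq_square)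
    next
      case 3
      have prod: "(x - w)\<^sup>2 \<le> (x - w) * (x - h * \<sigma>\<^sup>2)"
        unfolding power2_eq_square[of "x - w"] using 3 small by (intro mult_left_mono) auto
      have gap: "0 < K * (\<sigma>\<^sup>2 * w * (K - h))" using K hK pos by simp
      have "e * x\<^sup>2 \<le> K * ((x - w) * (x - h * \<sigma>\<^sup>2) + \<sigma>\<^sup>2 * w * (K - h))"
      proof (cases "x \<le> 2 * w")
        case True
        have "e * x\<^sup>2 \<le> e * (2 * w)\<^sup>2"
          using True 3 pos e0 by (intro mult_left_mono power_mono) auto
        also have "\<dots> \<le> K * (\<sigma>\<^sup>2 * (K - h)) / (4 * w) * (2 * w)\<^sup>2"
          using e(4) by (intro mult_right_mono) auto
        also have "\<dots> = K * (\<sigma>\<^sup>2 * w * (K - h))"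
          using pos by (simp add: power2_eq_square field_simps)
        also have "\<dots> \<le> K * ((x - w) * (x - h * \<sigma>\<^sup>2) + \<sigma>\<^sup>2 * w * (K - h))"
          using K prod zero_le_power2[of "x - w"] by (intro mult_left_mono) linarith+
        finally show ?thesis .
      next
        case False
        have "e * x\<^sup>2 \<le> K / 4 * x\<^sup>2" using e(3) by (intro mult_right_mono) auto
        also have "\<dots> = K * (x / 2)\<^sup>2" by (simp add: power2_eq_square)
        also have "\<dots> \<le> K * (x - w)\<^sup>2"
          using K False pos by (intro mult_left_mono power_mono) auto
        also have "\<dots> \<le> K * ((x - w) * (x - h * \<sigma>\<^sup>2))"
          using K prod by simp
        also have "\<dots> \<le> K * ((x - w) * (x - h * \<sigma>\<^sup>2) + \<sigma>\<^sup>2 * w * (K - h))"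
          using gap by (simp add: algebra_simps)
        finally show ?thesis .
      qed
      then show ?thesis
        using 3 by (simp add: Kw s_def algebra_simps power2_eq_square)
    qed
    then show "(x - K * \<sigma>\<^sup>2) * exp (h * min x w)
        \<le> (1 - h * (K * \<sigma>\<^sup>2)) * x + (K - e) * x\<^sup>2 + - (K * \<sigma>\<^sup>2)"
      by (simp add: s_def)
  qed
qed

text \<open>
  The line through the point of abscissa \<open>s\<close> and height \<open>exp (h * w)\<close> that vanishes at \<open>- V\<close>
  lies below \<open>\<phi> x = exp (h * min x w)\<close> where \<open>x - s\<close> is negative and above it elsewhere, so multiplication
  by \<open>x - s\<close> gives a majorant on both sides. Its expectation is proportional to \<open>\<sigma>\<^sup>2 - s * V\<close>, which
  is negative for \<open>V > 1 / K\<close>; but the line rises with \<open>V\<close>. So the comparison with \<open>\<phi>\<close> is made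
  strict at \<open>V = 1 / K\<close>, and \<open>V\<close> is then increased slightly. The worst line at \<open>V = 1 / K\<close> is that for the
  smallest \<open>s\<close>, where \<open>h * s = exp (h * w) - 1\<close>.
\<close>

lemma majorant_large_variance:
  fixes h w \<sigma> :: real
  defines "K \<equiv> (exp (h * w) - 1) / w"
  assumes pos: "0 < h" "0 < w" and large: "w \<le> h * \<sigma>\<^sup>2"
  obtains V where "0 < V" "\<sigma>\<^sup>2 < K * \<sigma>\<^sup>2 * V"
    "\<And>x. (x - K * \<sigma>\<^sup>2) * exp (h * min x w)
      \<le> exp (h * w) / (K * \<sigma>\<^sup>2 + V) * ((x - K * \<sigma>\<^sup>2) * (x + V))"
proof -
  define s where "s = K * \<sigma>\<^sup>2"
  have hK: "h < K" unfolding K_def using rate_less_chord_slope pos by blast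
  have K: "0 < K" using hK pos by simp
  have Kw: "exp (h * w) = 1 + K * w" using pos by (simp add: K_def)
  have \<sigma>: "0 < \<sigma>\<^sup>2" using large pos by (smt (verit) mult_nonneg_nonpos zero_less_power2 zero_le_power2)
  have s: "0 < s" using K \<sigma> by (simp add: s_def)
  have "K * w \<le> K * (h * \<sigma>\<^sup>2)" using large K by (intro mult_left_mono) auto
  then have hs: "exp (h * w) - 1 \<le> h * s"
    unfolding Kw s_def by (simp only: mult_ac add_diff_cancel_left')
  have ws: "w \<le> s" using large hK \<sigma> unfolding s_def
    by (meson less_eq_real_def mult_right_mono order_trans)
  \<comment> \<open>The tangent of \<open>exp\<close> at \<open>j\<close>, read as a function of \<open>h * x\<close>, has its zero at \<open>x = - (1 / K)\<close>, like the
    line for \<open>V = 1 / K\<close>; so comparing the two slopes suffices.\<close>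
  define j where "j = 1 - h / K"
  have j0: "0 < j" using hK K by (simp add: j_def)
  have jw: "j \<le> h * w"
  proof -
    have "1 - h * w \<le> exp (- (h * w))" using exp_ge_add_one_self[of "- (h * w)"] by simp
    then have "(1 - h * w) * exp (h * w) \<le> 1"
      by (simp add: exp_minus field_simps)
    then have "w * K \<le> w * (h + K * (h * w))" by (simp add: Kw algebra_simps)
    then have "K \<le> h + K * (h * w)" using pos by simp
    then show ?thesis using K by (simp add: j_def field_simps)
  qed
  have "exp (h * w) * exp (- j) < exp (h * w) - j"
  proof -
    have "exp j * (1 - exp (-j)) > j"
      using exp_minus_greater[of "- j"] j0 by (simp add: algebra_simps exp_minus)
    moreover have "exp j * (1 - exp (-j)) \<le> exp (h * w) * (1 - exp (-j))"
      using jw j0 by (intro mult_right_mono) auto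
    ultimately show ?thesis by (simp add: algebra_simps)
  qed
  then have gap: "0 < h * s + h * (1 / K) - exp (h * w) * exp (h * (1 / K) - 1)"
    using hs by (simp add: j_def)
  have "((\<lambda>V. h * s + h * V - exp (h * w) * exp (h * V - 1)) \<longlongrightarrow>
      h * s + h * (1 / K) - exp (h * w) * exp (h * (1 / K) - 1)) (at_right (1 / K))"
    by (intro tendsto_intros)
  then have "eventually (\<lambda>V. 0 < h * s + h * V - exp (h * w) * exp (h * V - 1)) (at_right (1 / K))"
    using gap by (rule order_tendstoD)
  then have "eventually (\<lambda>V. 0 < h * s + h * V - exp (h * w) * exp (h * V - 1) \<and> 1 / K < V)
      (at_right (1 / K))"
    using eventually_at_right_less by (rule eventually_conj)
  then obtain V where V: "exp (h * w) * exp (h * V - 1) < h * s + h * V" "1 / K < V"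
    using eventually_happens[of _ "at_right (1 / K)"] by auto
  have V0: "0 < V" using V(2) K by (smt (verit) divide_pos_pos)
  show ?thesis
  proof (rule that[of V])
    show "0 < V" by fact
    have "1 < K * V" using V(2) K by (simp add: field_simps)
    then show "\<sigma>\<^sup>2 < K * \<sigma>\<^sup>2 * V" using \<sigma> by (simp add: field_simps)
    fix x
    let ?l = "exp (h * w) / (s + V) * (x + V)"
    have sV: "0 < s + V" using s V0 by simp
    have "(x - s) * exp (h * min x w) \<le> (x - s) * ?l"
    proof (cases "s \<le> x")
      case True
      have "exp (h * w) * 1 \<le> exp (h * w) * ((x + V) / (s + V))"
        using True sV by (intro mult_left_mono) auto
      then show ?thesis using True ws by (intro mult_left_mono) auto
    next
      case False
      have "?l \<le> exp (h * min x w)"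
      proof (cases "w \<le> x")
        case True
        have "exp (h * w) * ((x + V) / (s + V)) \<le> exp (h * w) * 1"
          using False sV by (intro mult_left_mono) auto
        then show ?thesis using True by simp
      next
        case nw: False
        have tangent: "h * (x + V) \<le> exp (h * x) * exp (h * V - 1)"
          using exp_ge_add_one_self[of "h * x + h * V - 1"]
          by (simp add: algebra_simps flip: exp_add)
        have "exp (h * w) * (h * (x + V)) \<le> exp (h * w) * (exp (h * x) * exp (h * V - 1))"
          using tangent by (intro mult_left_mono) auto
        also have "\<dots> = exp (h * x) * (exp (h * w) * exp (h * V - 1))" by simp
        also have "\<dots> \<le> exp (h * x) * (h * s + h * V)"
          using V(1) by (intro mult_left_mono) auto
        finally have "h * (exp (h * w) * (x + V)) \<le> h * (exp (h * x) * (s + V))"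
          by (simp add: algebra_simps)
        then have "exp (h * w) * (x + V) \<le> exp (h * x) * (s + V)" using pos by simp
        then show ?thesis using sV nw by (simp add: field_simps)
      qed
      then show ?thesis using False by (intro mult_left_mono_neg) auto
    qed
    then show "(x - K * \<sigma>\<^sup>2) * exp (h * min x w)
      \<le> exp (h * w) / (K * \<sigma>\<^sup>2 + V) * ((x - K * \<sigma>\<^sup>2) * (x + V))"
      by (simp add: s_def mult_ac)
  qed
qed

section \<open>The strict bound on the supremum\<close>

lemma tilted_mean_sup_less:
  fixes h w \<sigma> :: real
  assumes pos: "0 < h" "0 < w" "0 < \<sigma>"
  shows "tilted_mean_sup h w \<sigma> < ereal ((exp (h * w) - 1) / w * \<sigma>\<^sup>2)"
proof -
  define s where "s = (exp (h * w) - 1) / w * \<sigma>\<^sup>2"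
  obtain a b d where neg: "b * \<sigma>\<^sup>2 + d < 0"
    and maj: "\<And>x. (x - s) * exp (h * min x w) \<le> a * x + b * x\<^sup>2 + d"
  proof (cases "h * \<sigma>\<^sup>2 \<le> w")
    case True
    obtain b where b: "b < (exp (h * w) - 1) / w"
      "\<And>x. (x - s) * exp (h * min x w) \<le> (1 - h * s) * x + b * x\<^sup>2 + - s"
      using majorant_small_variance[OF pos True] unfolding s_def by metis
    have "b * \<sigma>\<^sup>2 + - s < 0" using mult_strict_right_mono[OF b(1), of "\<sigma>\<^sup>2"] pos by (simp add: s_def)
    then show ?thesis using b(2) that by metis
  next
    case False
    obtain V where V: "0 < V" "\<sigma>\<^sup>2 < s * V"
      "\<And>x. (x - s) * exp (h * min x w) \<le> exp (h * w) / (s + V) * ((x - s) * (x + V))"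
      using majorant_large_variance[of h w \<sigma>] pos False unfolding s_def by (metis linear)
    have "0 < s" using rate_less_chord_slope[OF pos(1,2)] pos by (simp add: s_def)
    define b where "b = exp (h * w) / (s + V)"
    have "0 < b" using \<open>0 < s\<close> \<open>0 < V\<close> by (simp add: b_def)
    then have "b * \<sigma>\<^sup>2 + - (b * (s * V)) < 0" using V(2) by simp
    moreover have "(x - s) * exp (h * min x w) \<le> (b * (V - s)) * x + b * x\<^sup>2 + - (b * (s * V))" for x
      using V(3)[of x] unfolding b_def[symmetric] by (simp add: algebra_simps power2_eq_square)
    ultimately show ?thesis using that by blast
  qed
  have "tilted_mean_sup h w \<sigma> \<le> ereal (s + (b * \<sigma>\<^sup>2 + d) / exp (h * w))"
    unfolding tilted_mean_sup_def
  proof (rule Sup_least, safe)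
    fix M :: "real measure" and X
    assume X: "centered_rv M X \<sigma>"
    show "ereal (tilted_mean M X h w) \<le> ereal (s + (b * \<sigma>\<^sup>2 + d) / exp (h * w))"
      using tilted_mean_le_of_quadratic_majorant[OF X pos(1) maj] neg by simp
  qed
  also have "\<dots> < ereal s" using neg by (simp add: divide_neg_pos)
  finally show ?thesis by (simp add: s_def)
qed

section \<open>Monotonicity of the supremum in the variance\<close>

text \<open>
  The mixture is realized on a product space: an independent label selects \<open>X\<close> (label \<open>0\<close>)
  or one of the atoms \<open>R\<close> and \<open>- R\<close> (labels \<open>1\<close> and \<open>- 1\<close>).
\<close>

lemma mixture_integral:
  fixes X :: "'a \<Rightarrow> real" and g :: "real \<Rightarrow> real" and R p :: real
  defines "\<kappa> \<equiv> measure_pmf (pmf_of_list [(0 :: int, 1 - p), (1, p / 2), (- 1, p / 2)])"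
    and "Y \<equiv> \<lambda>(z, k). if k = 0 then X z else of_int k * R"
  assumes N: "prob_space N" and X [measurable]: "X \<in> borel_measurable N"
    and p: "0 \<le> p" "p \<le> 1"
    and g [measurable]: "g \<in> borel_measurable borel" and gX: "integrable N (\<lambda>z. g (X z))"
  shows "prob_space (N \<Otimes>\<^sub>M \<kappa>)" and "Y \<in> borel_measurable (N \<Otimes>\<^sub>M \<kappa>)"
    and "integrable (N \<Otimes>\<^sub>M \<kappa>) (\<lambda>s. g (Y s))"
    and "(\<integral>s. g (Y s) \<partial>(N \<Otimes>\<^sub>M \<kappa>)) = (1 - p) * (\<integral>z. g (X z) \<partial>N) + p / 2 * (g R + g (- R))"
proof -
  interpret N: prob_space N by fact
  let ?L = "[(0 :: int, 1 - p), (1, p / 2), (- 1, p / 2)]"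
  have wf: "pmf_of_list_wf ?L"
    by (rule pmf_of_list_wfI) (use p in auto)
  have supp: "set_pmf (pmf_of_list ?L) \<subseteq> {0, 1, - 1}"
    using set_pmf_of_list[OF wf] by simp
  have fin: "integrable \<kappa> f" for f :: "int \<Rightarrow> real"
    unfolding \<kappa>_def by (rule integrable_measure_pmf_finite) (rule finite_subset[OF supp], simp)
  have int: "(\<integral>k. f k \<partial>\<kappa>) = (1 - p) * f 0 + p / 2 * (f 1 + f (- 1))" for f :: "int \<Rightarrow> real"
    unfolding \<kappa>_def
    by (subst integral_measure_pmf[where A="{0, 1, - 1}"])
      (use supp in \<open>auto simp: pmf_pmf_of_list[OF wf] algebra_simps\<close>)
  interpret K: prob_space \<kappa> unfolding \<kappa>_def by (rule prob_space_measure_pmf)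
  interpret pair_prob_space N \<kappa> ..
  show "prob_space (N \<Otimes>\<^sub>M \<kappa>)" by (rule prob_space_axioms)
  have [measurable_cong]: "sets \<kappa> = sets (count_space UNIV)" by (simp add: \<kappa>_def)
  show Y [measurable]: "Y \<in> borel_measurable (N \<Otimes>\<^sub>M \<kappa>)"
    unfolding Y_def by measurable
  show i: "integrable (N \<Otimes>\<^sub>M \<kappa>) (\<lambda>s. g (Y s))"
  proof (rule Fubini_integrable)
    show "integrable N (\<lambda>z. \<integral>k. norm (g (Y (z, k))) \<partial>\<kappa>)"
      unfolding int using gX by (simp add: Y_def)
  qed (use fin in auto)
  show "(\<integral>s. g (Y s) \<partial>(N \<Otimes>\<^sub>M \<kappa>)) = (1 - p) * (\<integral>z. g (X z) \<partial>N) + p / 2 * (g R + g (- R))"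
    unfolding integral_fst'[OF i, symmetric] int using gX by (simp add: Y_def N.prob_space)
qed

text \<open>
  Mixing averages the numerators and the denominators of the tilted means with the same weights,
  so the tilted mean \<open>\<rho>\<close> of \<open>X\<close> does not decrease once that of the two atoms alone is at least \<open>\<rho>\<close>.
  The latter is at least \<open>R * (A - 1) / (A + 1)\<close> with \<open>A = exp (h * w) > 1\<close> as soon as \<open>R \<ge> w\<close>,
  and hence becomes arbitrarily large.
\<close>

lemma tilted_mean_le_sup_of_smaller_variance:
  assumes X: "centered_rv N X \<tau>" and var: "\<tau>\<^sup>2 \<le> \<sigma>\<^sup>2" and pos: "0 < h" "0 < w"
  shows "ereal (tilted_mean N X h w) \<le> tilted_mean_sup h w \<sigma>"
proof -
  interpret N: prob_space N using X by (simp add: centered_rv_def)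
  have meas: "X \<in> borel_measurable N" and iX: "integrable N X" "(\<integral>s. X s \<partial>N) = 0"
    and iX2: "integrable N (\<lambda>s. (X s)\<^sup>2)" "(\<integral>s. (X s)\<^sup>2 \<partial>N) = \<tau>\<^sup>2"
    using X by (auto simp: centered_rv_def)
  note tilt = tilt_integrals[OF N.prob_space_axioms iX(1) pos(1), of w]
  define \<rho> where "\<rho> = tilted_mean N X h w"
  define A where "A = exp (h * w)"
  have A: "1 < A" using pos by (simp add: A_def)
  define R where "R = w + \<bar>\<sigma>\<bar> + \<bar>\<rho>\<bar> * (A + 1) / (A - 1)"
  have q0: "0 \<le> \<bar>\<rho>\<bar> * (A + 1) / (A - 1)" using A by auto
  then have R: "w \<le> R" "\<bar>\<sigma>\<bar> < R" "\<bar>\<rho>\<bar> * (A + 1) / (A - 1) \<le> R"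
    using pos unfolding R_def by linarith+
  have R0: "0 < R" using R pos by simp
  have "\<sigma>\<^sup>2 < R\<^sup>2" using R(2) by (metis abs_ge_zero power2_abs power_strict_mono pos2)
  then have R\<tau>: "0 < R\<^sup>2 - \<tau>\<^sup>2" using var by simp
  \<comment> \<open>The weight that turns variance \<open>\<tau>\<^sup>2\<close> into \<open>\<sigma>\<^sup>2\<close>.\<close>
  define p where "p = (\<sigma>\<^sup>2 - \<tau>\<^sup>2) / (R\<^sup>2 - \<tau>\<^sup>2)"
  have p: "0 \<le> p" "p \<le> 1"
    using var R\<tau> \<open>\<sigma>\<^sup>2 < R\<^sup>2\<close> by (auto simp: p_def)
  have "p * (R\<^sup>2 - \<tau>\<^sup>2) = \<sigma>\<^sup>2 - \<tau>\<^sup>2" using R\<tau> by (simp add: p_def)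
  then have var_eq: "(1 - p) * \<tau>\<^sup>2 + p * R\<^sup>2 = \<sigma>\<^sup>2" by (simp add: algebra_simps)
  define Q where "Q = N \<Otimes>\<^sub>M measure_pmf (pmf_of_list [(0 :: int, 1 - p), (1, p / 2), (- 1, p / 2)])"
  define Y where "Y = (\<lambda>(z, k :: int). if k = 0 then X z else of_int k * R)"
  have Q: "prob_space Q"
    unfolding Q_def by (rule mixture_integral(1)[OF N.prob_space_axioms meas p, where g="\<lambda>x. x"]) (use iX in auto)
  note mix = mixture_integral(2-4)[OF N.prob_space_axioms meas p, where R=R, folded Q_def Y_def]
  have Y: "centered_rv Q Y \<sigma>"
    unfolding centered_rv_def
  proof (intro conjI)
    show "prob_space Q" by (rule Q)
    show "Y \<in> borel_measurable Q" "integrable Q Y" "(\<integral>s. Y s \<partial>Q) = 0"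
      using mix[of "\<lambda>x. x"] iX by auto
    show "integrable Q (\<lambda>s. (Y s)\<^sup>2)" "(\<integral>s. (Y s)\<^sup>2 \<partial>Q) = \<sigma>\<^sup>2"
      using mix[of "\<lambda>x. x\<^sup>2"] iX2 var_eq by auto
  qed
  have "\<rho> \<le> tilted_mean Q Y h w"
  proof -
    let ?D = "\<integral>z. exp (h * min (X z) w) \<partial>N"
    let ?e = "exp (- (h * R))"
    have num: "(\<integral>s. Y s * exp (h * min (Y s) w) \<partial>Q) = (1 - p) * (\<rho> * ?D) + p / 2 * (R * (A - ?e))"
      using mix(3)[of "\<lambda>x. x * exp (h * min x w)"] tilt R(1) R0 pos
      by (simp add: \<rho>_def tilted_mean_def A_def algebra_simps)
    have den: "(\<integral>s. exp (h * min (Y s) w) \<partial>Q) = (1 - p) * ?D + p / 2 * (A + ?e)"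
      using mix(3)[of "\<lambda>x. exp (h * min x w)"] tilt R(1) R0 pos by (simp add: A_def)
    have "?e \<le> 1" using R0 pos by simp
    have "\<rho> * (A + ?e) \<le> \<bar>\<rho>\<bar> * (A + ?e)" using A by (intro mult_right_mono) (auto intro: add_nonneg_nonneg)
    also have "\<dots> \<le> \<bar>\<rho>\<bar> * (A + 1)" using \<open>?e \<le> 1\<close> by (intro mult_left_mono) auto
    also have "\<dots> \<le> R * (A - 1)" using R(3) A by (simp add: divide_le_eq)
    also have "\<dots> \<le> R * (A - ?e)" using \<open>?e \<le> 1\<close> R0 by (intro mult_left_mono) auto
    finally have "p / 2 * (\<rho> * (A + ?e)) \<le> p / 2 * (R * (A - ?e))"
      using p by (intro mult_left_mono) auto
    then have "\<rho> * (\<integral>s. exp (h * min (Y s) w) \<partial>Q) \<le> (\<integral>s. Y s * exp (h * min (Y s) w) \<partial>Q)"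
      unfolding num den by (simp add: algebra_simps)
    moreover have "0 < (\<integral>s. exp (h * min (Y s) w) \<partial>Q)"
      using Y by (intro tilt_integrals(3)[OF _ _ pos(1)]) (auto simp: centered_rv_def)
    ultimately show ?thesis by (simp add: tilted_mean_def le_divide_eq)
  qed
  also have "ereal (tilted_mean Q Y h w) \<le> tilted_mean_sup h w \<sigma>"
    unfolding tilted_mean_sup_def by (rule Sup_upper) (rule tilted_mean_mem[OF Y])
  finally show ?thesis by (simp add: \<rho>_def)
qed

section \<open>The posterior mean\<close>

text \<open>
  This excludes \<open>m = \<theta>max\<close>: since \<open>\<theta> \<le> \<theta>max\<close>, equality of the mean would concentrate the prior
  at \<open>\<theta>max\<close>.
\<close>

lemma measure_support_singleton:
  fixes \<pi> :: "real measure"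
  assumes sets: "sets \<pi> = sets (restrict_space borel \<Theta>)" and nz: "emeasure \<pi> \<Theta> \<noteq> 0"
    and null: "AE \<theta> in \<pi>. \<theta> = a"
  shows "measure_support \<pi> = {a}"
proof -
  have sp: "space \<pi> = \<Theta>"
    using sets_eq_imp_space_eq[OF sets] by (simp add: space_restrict_space)
  have open_sets: "U \<in> sets \<pi>" if "openin (top_of_set \<Theta>) U" for U
    using that unfolding sets openin_open sets_restrict_space by auto
  have eq_top: "emeasure \<pi> U = emeasure \<pi> \<Theta>"
    if U: "openin (top_of_set \<Theta>) U" "a \<in> U" for U
  proof (rule emeasure_eq_AE)
    show "AE \<theta> in \<pi>. \<theta> \<in> U \<longleftrightarrow> \<theta> \<in> \<Theta>"
      using null
    proof eventually_elim
      case (elim \<theta>)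
      then show ?case using U openin_imp_subset by blast
    qed
  qed (use open_sets U in auto)
  have eq_0: "emeasure \<pi> U = 0"
    if U: "openin (top_of_set \<Theta>) U" "a \<notin> U" for U
  proof -
    have "AE \<theta> in \<pi>. \<theta> \<in> U \<longleftrightarrow> \<theta> \<in> {}"
      using null by eventually_elim (use U in simp)
    then have "emeasure \<pi> U = emeasure \<pi> {}"
      by (rule emeasure_eq_AE) (use open_sets U in auto)
    then show ?thesis by simp
  qed
  have "a \<in> \<Theta>"
    using eq_0[of \<Theta>] nz by auto
  have "openin (top_of_set \<Theta>) (\<Theta> - {a})"
    by (simp add: openin_delete)
  then have "\<Theta> - {a} \<subseteq> \<Union>{U. openin (top_of_set \<Theta>) U \<and> emeasure \<pi> U = 0}"
    using eq_0 by blast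
  moreover have "a \<notin> \<Union>{U. openin (top_of_set \<Theta>) U \<and> emeasure \<pi> U = 0}"
    using eq_top nz by auto
  ultimately show ?thesis
    unfolding measure_support_def sp using \<open>a \<in> \<Theta>\<close> by blast
qed

theorem mainTheorem4:
  fixes M :: "'x measure"
    and \<Theta> :: "real set"
    and \<pi> :: "real measure"
    and p :: "'x \<Rightarrow> real \<Rightarrow> real"
    and c :: "real \<Rightarrow> real"
    and T q :: "'x \<Rightarrow> real"
    and \<theta>max m \<sigma> :: real
  assumes Theta: "\<Theta> \<noteq> {}" "\<Theta> \<in> sets borel"
    and c: "c \<in> borel_measurable (restrict_space borel \<Theta>)" "\<And>\<theta>. \<theta> \<in> \<Theta> \<Longrightarrow> 0 < c \<theta>"
    and T: "T \<in> borel_measurable M" "\<And>x. x \<in> space M \<Longrightarrow> 0 \<le> T x"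
    and q: "q \<in> borel_measurable M" "\<And>x. x \<in> space M \<Longrightarrow> 0 \<le> q x"
    and p_form: "\<And>x \<theta>. x \<in> space M \<Longrightarrow> \<theta> \<in> \<Theta> \<Longrightarrow> p x \<theta> = exp (\<theta> * T x) * c \<theta> * q x"
    and p_measurable: "(\<lambda>(x, \<theta>). p x \<theta>) \<in> borel_measurable (M \<Otimes>\<^sub>M restrict_space borel \<Theta>)"
    and p_density: "\<And>\<theta>. \<theta> \<in> \<Theta> \<Longrightarrow> (\<integral>\<^sup>+x. ennreal (p x \<theta>) \<partial>M) = 1"
    and sup_Theta: "bdd_above \<Theta>" "\<theta>max = Sup \<Theta>"
    and prior: "sets \<pi> = sets (restrict_space borel \<Theta>)"
    and normalized: "(\<integral>\<^sup>+\<theta>. ennreal (c \<theta>) \<partial>\<pi>) = 1"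
    and support: "measure_support \<pi> \<noteq> {\<theta>max}"
    and m: "m = (\<integral>\<theta>. \<theta> * c \<theta> \<partial>\<pi>)"
    and sigma: "0 < \<sigma>"
    and variance: "(\<integral>\<^sup>+\<theta>. ennreal ((\<theta> - m)\<^sup>2 * c \<theta>) \<partial>\<pi>) \<le> ennreal (\<sigma>\<^sup>2)"
  shows "m < \<theta>max
    \<and> (\<forall>x\<in>space M. q x \<noteq> 0 \<longrightarrow>
          posterior_mean \<pi> p x =
            (\<integral>\<theta>. \<theta> * exp (\<theta> * T x) * c \<theta> \<partial>\<pi>) / (\<integral>\<theta>. exp (\<theta> * T x) * c \<theta> \<partial>\<pi>))
    \<and> (\<forall>x\<in>space M. q x \<noteq> 0 \<longrightarrow> 0 < T x \<longrightarrow>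
          ereal (posterior_mean \<pi> p x - m) \<le> tilted_mean_sup (T x) (\<theta>max - m) \<sigma>
        \<and> tilted_mean_sup (T x) (\<theta>max - m) \<sigma>
            < ereal ((exp ((\<theta>max - m) * T x) - 1) / (\<theta>max - m) * \<sigma>\<^sup>2))"
proof -
  have sp: "space \<pi> = \<Theta>"
    using sets_eq_imp_space_eq[OF prior] by (simp add: space_restrict_space)
  have [measurable]: "c \<in> borel_measurable \<pi>"
    using c(1) by (simp cong: measurable_cong_sets[OF prior refl])
  have id_pi: "(\<lambda>\<theta>. \<theta>) \<in> borel_measurable (restrict_space borel \<Theta>)"
    by (rule measurable_restrict_space1) simp
  then have [measurable]: "(\<lambda>\<theta>. \<theta>) \<in> borel_measurable \<pi>"
    by (simp cong: measurable_cong_sets[OF prior refl])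
  have c_pos: "0 < c \<theta>" if "\<theta> \<in> space \<pi>" for \<theta>
    using c(2) that sp by simp
  then have c_nn: "AE \<theta> in \<pi>. 0 \<le> c \<theta>" by (auto intro: less_imp_le)
  define \<mu> where "\<mu> = density \<pi> (\<lambda>\<theta>. ennreal (c \<theta>))"
  have sets_mu [measurable_cong]: "sets \<mu> = sets \<pi>" by (simp add: \<mu>_def)
  have int_mu: "(\<integral>\<theta>. f \<theta> \<partial>\<mu>) = (\<integral>\<theta>. f \<theta> * c \<theta> \<partial>\<pi>)"
    if [measurable]: "f \<in> borel_measurable \<pi>" for f :: "real \<Rightarrow> real"
    unfolding \<mu>_def using c_nn by (subst integral_density) (auto simp: mult.commute)
  interpret \<mu>: prob_space \<mu>
    by (rule prob_spaceI) (use normalized in \<open>simp add: \<mu>_def emeasure_density\<close>)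
  have "(\<integral>\<^sup>+\<theta>. ennreal ((\<theta> - m)\<^sup>2) \<partial>\<mu>) = (\<integral>\<^sup>+\<theta>. ennreal ((\<theta> - m)\<^sup>2 * c \<theta>) \<partial>\<pi>)"
    unfolding \<mu>_def
    by (subst nn_integral_density)
      (auto intro!: nn_integral_cong simp: ennreal_mult'' less_imp_le[OF c_pos] mult.commute)
  then have nn_var: "(\<integral>\<^sup>+\<theta>. ennreal ((\<theta> - m)\<^sup>2) \<partial>\<mu>) \<le> ennreal (\<sigma>\<^sup>2)"
    using variance by simp
  have i2: "integrable \<mu> (\<lambda>\<theta>. (\<theta> - m)\<^sup>2)"
    by (rule integrableI_nonneg) (use le_less_trans[OF nn_var ennreal_less_top] in auto)
  then have var_le: "(\<integral>\<theta>. (\<theta> - m)\<^sup>2 \<partial>\<mu>) \<le> \<sigma>\<^sup>2"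
    using nn_var by (simp add: nn_integral_eq_integral)
  have i1: "integrable \<mu> (\<lambda>\<theta>. \<theta> - m)"
    by (rule \<mu>.square_integrable_imp_integrable) (use i2 in auto)
  then have i0: "integrable \<mu> (\<lambda>\<theta>. \<theta>)"
    using Bochner_Integration.integrable_add[OF i1 \<mu>.integrable_const[of m]] by simp
  have "(\<integral>\<theta>. \<theta> \<partial>\<mu>) = m" using m by (simp add: int_mu)
  then have mean: "(\<integral>\<theta>. \<theta> - m \<partial>\<mu>) = 0"
    using i0 by (simp add: \<mu>.prob_space)
  have le_max: "\<theta> \<le> \<theta>max" if "\<theta> \<in> space \<mu>" for \<theta>
    using that sup_Theta cSup_upper by (auto simp: \<mu>_def sp)
  have m_less: "m < \<theta>max"
  proof (rule ccontr)
    assume "\<not> m < \<theta>max"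
    then have nn: "AE \<theta> in \<mu>. 0 \<le> m - \<theta>" using le_max by force
    have i: "integrable \<mu> (\<lambda>\<theta>. m - \<theta>)" using i0 by simp
    have "(\<integral>\<theta>. m - \<theta> \<partial>\<mu>) = 0" using i0 mean by (simp add: \<mu>.prob_space)
    then have "AE \<theta> in \<mu>. m - \<theta> = 0"
      using integral_nonneg_eq_0_iff_AE[OF i nn] by simp
    then have AE_mu: "AE \<theta> in \<mu>. \<theta> = \<theta>max"
      using AE_space
    proof eventually_elim
      case (elim \<theta>)
      then show ?case using \<open>\<not> m < \<theta>max\<close> le_max[of \<theta>] by simp
    qed
    then have "AE \<theta> in \<pi>. \<theta> = \<theta>max"
      unfolding \<mu>_def by (subst (asm) AE_density) (use c_pos in auto)
    moreover have "emeasure \<pi> \<Theta> \<noteq> 0"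
    proof
      assume "emeasure \<pi> \<Theta> = 0"
      then have "AE \<theta> in \<pi>. ennreal (c \<theta>) = 0"
        by (intro AE_I'[of \<Theta>]) (auto simp: sp[symmetric] null_sets_def)
      then have "(\<integral>\<^sup>+\<theta>. ennreal (c \<theta>) \<partial>\<pi>) = (\<integral>\<^sup>+\<theta>. 0 \<partial>\<pi>)"
        by (rule nn_integral_cong_AE)
      then show False using normalized by simp
    qed
    ultimately show False
      using support measure_support_singleton[OF prior] by blast
  qed
  define w where "w = \<theta>max - m"
  have w: "0 < w" using m_less by (simp add: w_def)
  define \<tau> where "\<tau> = sqrt (\<integral>\<theta>. (\<theta> - m)\<^sup>2 \<partial>\<mu>)"
  have \<tau>2: "\<tau>\<^sup>2 = (\<integral>\<theta>. (\<theta> - m)\<^sup>2 \<partial>\<mu>)" by (simp add: \<tau>_def)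
  have X: "centered_rv \<mu> (\<lambda>\<theta>. \<theta> - m) \<tau>"
    unfolding centered_rv_def using i1 i2 mean \<tau>2 \<mu>.prob_space_axioms by simp
  have post: "posterior_mean \<pi> p x =
      (\<integral>\<theta>. \<theta> * exp (\<theta> * T x) * c \<theta> \<partial>\<pi>) / (\<integral>\<theta>. exp (\<theta> * T x) * c \<theta> \<partial>\<pi>)"
    if x: "x \<in> space M" "q x \<noteq> 0" for x
  proof -
    have "(\<integral>\<theta>. \<theta> * p x \<theta> \<partial>\<pi>) = (\<integral>\<theta>. \<theta> * exp (\<theta> * T x) * c \<theta> * q x \<partial>\<pi>)"
      by (rule Bochner_Integration.integral_cong) (use p_form x sp in auto)
    moreover have "(\<integral>\<theta>. p x \<theta> \<partial>\<pi>) = (\<integral>\<theta>. exp (\<theta> * T x) * c \<theta> * q x \<partial>\<pi>)"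
      by (rule Bochner_Integration.integral_cong) (use p_form x sp in auto)
    ultimately show ?thesis using x by (simp add: posterior_mean_def)
  qed
  have tilt: "posterior_mean \<pi> p x - m = tilted_mean \<mu> (\<lambda>\<theta>. \<theta> - m) (T x) w"
    if x: "x \<in> space M" "q x \<noteq> 0" and t: "0 < T x" for x
  proof -
    let ?t = "T x"
    note ti = tilt_integrals[OF \<mu>.prob_space_axioms i1 t, of w]
    have min_w: "min (\<theta> - m) w = \<theta> - m" if "\<theta> \<in> space \<mu>" for \<theta>
      using le_max[OF that] by (simp add: w_def)
    have shift: "exp (?t * (\<theta> - m)) = exp (\<theta> * ?t) * exp (- (?t * m))" for \<theta>
      by (simp add: right_diff_distrib mult.commute flip: exp_add)
    let ?D = "\<integral>\<theta>. exp (?t * (\<theta> - m)) \<partial>\<mu>"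
    have iD: "integrable \<mu> (\<lambda>\<theta>. exp (?t * (\<theta> - m)))"
      using ti(1) by (simp add: min_w cong: Bochner_Integration.integrable_cong)
    have iN: "integrable \<mu> (\<lambda>\<theta>. (\<theta> - m) * exp (?t * (\<theta> - m)))"
      using ti(2) by (simp add: min_w cong: Bochner_Integration.integrable_cong)
    have D: "0 < ?D"
      using ti(3) by (simp add: min_w cong: Bochner_Integration.integral_cong)
    have "posterior_mean \<pi> p x = (\<integral>\<theta>. \<theta> * exp (\<theta> * ?t) \<partial>\<mu>) / (\<integral>\<theta>. exp (\<theta> * ?t) \<partial>\<mu>)"
      using post[OF x] by (simp add: int_mu)
    also have "\<dots> = (\<integral>\<theta>. \<theta> * exp (?t * (\<theta> - m)) \<partial>\<mu>) / ?D"
      unfolding shift by (simp flip: mult.assoc)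
    also have "(\<integral>\<theta>. \<theta> * exp (?t * (\<theta> - m)) \<partial>\<mu>) =
        (\<integral>\<theta>. (\<theta> - m) * exp (?t * (\<theta> - m)) + m * exp (?t * (\<theta> - m)) \<partial>\<mu>)"
      by (simp add: algebra_simps)
    also have "\<dots> = (\<integral>\<theta>. (\<theta> - m) * exp (?t * (\<theta> - m)) \<partial>\<mu>) + m * ?D"
      using iN iD by simp
    finally have "posterior_mean \<pi> p x - m = (\<integral>\<theta>. (\<theta> - m) * exp (?t * (\<theta> - m)) \<partial>\<mu>) / ?D"
      using D by (simp add: add_divide_distrib)
    then show ?thesis
      by (simp add: tilted_mean_def min_w cong: Bochner_Integration.integral_cong)
  qed
  show ?thesis
    unfolding w_def[symmetric]
  proof (intro conjI ballI impI)
    show "m < \<theta>max" by (rule m_less)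
  next
    fix x assume "x \<in> space M" "q x \<noteq> 0"
    then show "posterior_mean \<pi> p x =
      (\<integral>\<theta>. \<theta> * exp (\<theta> * T x) * c \<theta> \<partial>\<pi>) / (\<integral>\<theta>. exp (\<theta> * T x) * c \<theta> \<partial>\<pi>)" by (rule post)
  next
    fix x assume x: "x \<in> space M" "q x \<noteq> 0" "0 < T x"
    show "ereal (posterior_mean \<pi> p x - m) \<le> tilted_mean_sup (T x) w \<sigma>"
      unfolding tilt[OF x]
      by (rule tilted_mean_le_sup_of_smaller_variance[OF X _ x(3) w]) (use var_le \<tau>2 in simp)
    show "tilted_mean_sup (T x) w \<sigma> < ereal ((exp (w * T x) - 1) / w * \<sigma>\<^sup>2)"
      using tilted_mean_sup_less[OF x(3) w sigma] by (simp add: mult.commute)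
  qed
qed

end
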